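(* Let $G$ be a totally ordered group (not necessarily abelian, written additively) and let $R=\bigoplus_{n\in G}R_n$ be a $G$-graded ring (not necessarily commutative). If $I$ is an unfaithful left ideal of $R$ (not necessarily graded), i.e. $\{r\in R: rI=0\}\neq 0$, then there exists a nonzero homogeneous element $g\in R$ such that $gI=0$.
   Context: Rings are associative with identity. A $G$-graded ring is a ring $R$ with a decomposition $R=\bigoplus_{n\in G}R_n$ of its additive group into subgroups with $R_mR_n\subseteq R_{m+n}$ for all $m,n\in G$. A homogeneous element is a nonzero element of some $R_n$. A totally ordered group is a group with a total order $<$ such that $a<b$ implies $a+x<b+x$ and $x+a<x+b$ for all $x$. A left ideal $I$ is unfaithful if its annihilator $\operatorname{Ann}_R(I)=\{r\in R: rI=0\}$ as a left $R$-module is nonzero. *)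

theory Defs
  imports Main
begin

class totally_ordered_group_add = group_add + linorder +
  assumes add_strict_left_mono_grp: "a < b \<Longrightarrow> c + a < c + b"
    and add_strict_right_mono_grp: "a < b \<Longrightarrow> a + c < b + c"

definition add_subgroup :: "'r::group_add set \<Rightarrow> bool" where
  "add_subgroup H \<longleftrightarrow>
     0 \<in> H \<and> (\<forall>x\<in>H. \<forall>y\<in>H. x + y \<in> H) \<and> (\<forall>x\<in>H. - x \<in> H)"

text \<open>
  The additive group is the internal direct sum of the subgroups \<open>R n\<close>: every element is the sum
  of exactly one finitely supported family with \<open>n\<close>-th entry in \<open>R n\<close>.
\<close>

definition internal_direct_sum :: "('g \<Rightarrow> 'r::ab_group_add set) \<Rightarrow> bool" where
  "internal_direct_sum R \<longleftrightarrow>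
     (\<forall>n. add_subgroup (R n)) \<and>
     (\<forall>r. \<exists>!f. finite {n. f n \<noteq> 0} \<and> (\<forall>n. f n \<in> R n) \<and> r = (\<Sum>n | f n \<noteq> 0. f n))"

text \<open>
  Rings with identity have sort \<open>{ring, monoid_mult}\<close> rather than \<open>ring_1\<close>, which would exclude
  the zero ring by its axiom \<open>0 \<noteq> 1\<close>.
\<close>

definition ring_grading :: "('g::group_add \<Rightarrow> 'r::{ring, monoid_mult} set) \<Rightarrow> bool" where
  "ring_grading R \<longleftrightarrow>
     internal_direct_sum R \<and> (\<forall>m n. \<forall>x\<in>R m. \<forall>y\<in>R n. x * y \<in> R (m + n))"

definition homogeneous :: "('g \<Rightarrow> 'r::zero set) \<Rightarrow> 'r \<Rightarrow> bool" where
  "homogeneous R x \<longleftrightarrow> x \<noteq> 0 \<and> (\<exists>n. x \<in> R n)"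

definition left_ideal :: "'r::ring set \<Rightarrow> bool" where
  "left_ideal I \<longleftrightarrow> add_subgroup I \<and> (\<forall>r. \<forall>x\<in>I. r * x \<in> I)"

definition annihilator :: "'r::ring set \<Rightarrow> 'r set" where
  "annihilator I = {r. \<forall>x\<in>I. r * x = 0}"

definition unfaithful :: "'r::ring set \<Rightarrow> bool" where
  "unfaithful I \<longleftrightarrow> annihilator I \<noteq> {0}"

end

theory Submission imports Defs begin

text \<open>
  As \<open>I\<close> is a left ideal, its annihilator \<open>A\<close> is two-sided. Let \<open>r \<noteq> 0\<close> be an element of \<open>A\<close> with the
  fewest homogeneous components, and let \<open>r * y = 0\<close>. The product of the top components of \<open>r\<close> and \<open>y\<close>
  vanishes, so \<open>r * y\<^sub>b \<in> A\<close>, for the top component \<open>y\<^sub>b\<close> of \<open>y\<close>, has fewer components than \<open>r\<close>,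
  and thus is \<open>0\<close>. Passing to \<open>y - y\<^sub>b\<close> and repeating, \<open>r\<close> kills every component of \<open>y\<close>; comparing
  degrees, every component of \<open>r\<close> kills \<open>y\<close>. For \<open>y \<in> I\<close> this says that the components of \<open>r\<close> lie
  in \<open>A\<close>.
\<close>

lemma add_subgroup_sum:
  fixes H :: "'r::ab_group_add set"
  assumes "add_subgroup H" and "\<And>i. i \<in> F \<Longrightarrow> f i \<in> H"
  shows "sum f F \<in> H"
  using assms(2)
proof (induction F rule: infinite_finite_induct)
  case (insert x F)
  then show ?case using assms(1) by (simp add: add_subgroup_def)
qed (use assms(1) in \<open>auto simp: add_subgroup_def\<close>)

lemma internal_direct_sum_decompose:
  assumes "internal_direct_sum R"
  obtains F f where "finite F" "\<And>n. n \<in> F \<Longrightarrow> f n \<in> R n" "r = sum f F"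
  using assms unfolding internal_direct_sum_def by metis

text \<open>Extended by zero outside \<open>F\<close>, the family decomposes 0, as does the zero
  family; uniqueness identifies them.\<close>

lemma internal_direct_sum_eq_0:
  assumes R: "internal_direct_sum R"
    and F: "finite F" "\<And>n. n \<in> F \<Longrightarrow> f n \<in> R n"
    and sum: "sum f F = 0" and n: "n \<in> F"
  shows "f n = 0"
proof -
  define g where "g = (\<lambda>n. if n \<in> F then f n else 0)"
  define P where "P = (\<lambda>f. finite {n. f n \<noteq> 0} \<and> (\<forall>n. f n \<in> R n) \<and> 0 = (\<Sum>n | f n \<noteq> 0. f n))"
  have zero: "0 \<in> R n" for n
    using R by (auto simp: internal_direct_sum_def add_subgroup_def)
  have sub: "{n. g n \<noteq> 0} \<subseteq> F"
    by (auto simp: g_def split: if_splits)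
  have "(\<Sum>n | g n \<noteq> 0. g n) = sum g F"
    using F(1) sub by (intro sum.mono_neutral_left) auto
  also have "\<dots> = 0"
    using sum by (simp add: g_def)
  finally have "P g"
    using F sub zero by (auto simp: P_def g_def intro: finite_subset)
  moreover have "P (\<lambda>_. 0)"
    using zero by (simp add: P_def)
  moreover have "\<exists>!f. P f"
    using R[unfolded internal_direct_sum_def, THEN conjunct2] unfolding P_def by (rule spec)
  ultimately have "g = (\<lambda>_. 0)"
    by blast
  then show ?thesis
    using n by (metis g_def)
qed

text \<open>Right translation by \<open>b\<close> is injective, so the products
  \<open>f n * y\<close> lie in distinct degrees \<open>n + b\<close> and cannot cancel.\<close>

lemma ring_grading_sum_mult_homogeneous_eq_0:
  assumes R: "ring_grading R"
    and S: "finite S" "\<And>n. n \<in> S \<Longrightarrow> f n \<in> R n"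
    and y: "y \<in> R b" and eq: "sum f S * y = 0" and a: "a \<in> S"
  shows "f a * y = 0"
proof -
  \<comment> \<open>Indexed by its degree \<open>m = n + b\<close>, the product is
    \<open>f (m - b) * y\<close>; here \<open>m = a + b\<close>.\<close>
  have "f (a + b - b) * y = 0"
  proof (rule internal_direct_sum_eq_0[where R = R and F = "(\<lambda>n. n + b) ` S" and n = "a + b"])
    show "(\<Sum>n\<in>(\<lambda>n. n + b) ` S. f (n - b) * y) = 0"
      using eq by (subst sum.reindex) (auto simp: inj_on_def sum_distrib_right)
  qed (use R S y a in \<open>auto simp: ring_grading_def\<close>)
  then show ?thesis by simp
qed

text \<open>Strict monotonicity on both sides makes \<open>(a, b)\<close> the only pair in
  \<open>S \<times> T\<close> with sum \<open>a + b\<close>, so \<open>f a * h b\<close> is the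
  whole component of the product in that degree.\<close>

lemma ring_grading_top_mult_eq_0:
  fixes R :: "'g::totally_ordered_group_add \<Rightarrow> 'r::{ring, monoid_mult} set"
  assumes R: "ring_grading R"
    and S: "finite S" "\<And>n. n \<in> S \<Longrightarrow> f n \<in> R n" "a \<in> S" "\<And>n. n \<in> S \<Longrightarrow> n \<le> a"
    and T: "finite T" "\<And>n. n \<in> T \<Longrightarrow> h n \<in> R n" "b \<in> T" "\<And>n. n \<in> T \<Longrightarrow> n \<le> b"
    and eq: "sum f S * sum h T = 0"
  shows "f a * h b = 0"
proof -
  let ?N = "(\<lambda>z. fst z + snd z) ` (S \<times> T)"
  \<comment> \<open>The component of the product in degree \<open>n\<close>.\<close>
  let ?k = "\<lambda>n. \<Sum>z | z \<in> S \<times> T \<and> fst z + snd z = n. f (fst z) * h (snd z)"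
  have "p + q < a + b" if "p \<in> S" "q \<in> T" "(p, q) \<noteq> (a, b)" for p q
  proof (cases "p = a")
    case True
    then show ?thesis
      using that T(4)[of q] by (auto intro: add_strict_left_mono_grp)
  next
    case False
    then have "p + q < a + q"
      using that S(4)[of p] by (auto intro: add_strict_right_mono_grp)
    also have "a + q \<le> a + b"
      using that T(4)[of q] add_strict_left_mono_grp[of q b a]
      by (cases "q = b") (simp_all add: order_less_imp_le)
    finally show ?thesis .
  qed
  then have *: "{z. z \<in> S \<times> T \<and> fst z + snd z = a + b} = {(a, b)}"
    using S(3) T(3) by fastforce
  have "?k (a + b) = 0"
  proof (rule internal_direct_sum_eq_0[where R = R and F = ?N and n = "a + b"])
    show "?k n \<in> R n" for n
      using R S(2) T(2)
      by (intro add_subgroup_sum) (auto simp: ring_grading_def internal_direct_sum_def)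
    have "(\<Sum>n\<in>?N. ?k n) = (\<Sum>z\<in>S \<times> T. f (fst z) * h (snd z))"
      using S(1) T(1) by (intro sum.image_gen[symmetric] finite_cartesian_product)
    also have "\<dots> = 0"
      using eq by (simp add: sum_product sum.cartesian_product case_prod_unfold)
    finally show "(\<Sum>n\<in>?N. ?k n) = 0" .
    show "a + b \<in> ?N"
      using S(3) T(3) by force
  qed (use R S(1) T(1) in \<open>auto simp: ring_grading_def\<close>)
  then show ?thesis
    unfolding * by simp
qed

theorem theorem4p1:
  fixes R :: "'g::totally_ordered_group_add \<Rightarrow> 'r::{ring, monoid_mult} set"
    and I :: "'r set"
  assumes "ring_grading R"
    and "left_ideal I"
    and "unfaithful I"
  shows "\<exists>g. homogeneous R g \<and> (\<forall>x\<in>I. g * x = 0)"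
proof -
  note R = assms(1)
  have D: "internal_direct_sum R"
    using R by (simp add: ring_grading_def)
  define A where "A = annihilator I"
  have A_mult: "r * s \<in> A" if "r \<in> A" for r s
    using that assms(2) by (simp add: A_def annihilator_def left_ideal_def mult.assoc)
  \<comment> \<open>Length is measured by the index set of a representation whose entries may
    vanish, so the representation of \<open>r * y\<close> built below need not be trimmed to its
    support.\<close>
  define P where "P = (\<lambda>(S, f). finite S \<and> (\<forall>n\<in>S. f n \<in> R n) \<and> sum f S \<in> A \<and> sum f S \<noteq> 0)"
  have "0 \<in> A"
    by (simp add: A_def annihilator_def)
  then obtain r0 where "r0 \<in> A" "r0 \<noteq> 0"
    using assms(3) by (auto simp: unfaithful_def A_def)
  moreover obtain S0 f0 where "finite S0" "\<And>n. n \<in> S0 \<Longrightarrow> f0 n \<in> R n" "r0 = sum f0 S0"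
    using internal_direct_sum_decompose[OF D, of r0] by metis
  ultimately have "P (S0, f0)"
    by (simp add: P_def)
  then obtain z where "P z" and min: "\<And>z'. P z' \<Longrightarrow> card (fst z) \<le> card (fst z')"
    using ex_has_least_nat[of P "(S0, f0)" "\<lambda>z. card (fst z)"] by blast
  obtain S f where z: "z = (S, f)" by fastforce
  define r where "r = sum f S"
  have S: "finite S" "\<And>n. n \<in> S \<Longrightarrow> f n \<in> R n" and r: "r \<in> A" "r \<noteq> 0"
    using \<open>P z\<close> by (auto simp: z P_def r_def)
  then have "S \<noteq> {}"
    by (auto simp: r_def)
  define a where "a = Max S"
  have a: "a \<in> S" "\<And>n. n \<in> S \<Longrightarrow> n \<le> a"
    using S(1) \<open>S \<noteq> {}\<close> by (auto simp: a_def)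
  have kill: "r * y = 0" if y: "y \<in> R b" and top: "f a * y = 0" for y b
  proof (rule ccontr)
    assume "r * y \<noteq> 0"
    \<comment> \<open>Since \<open>f a * y = 0\<close>, the translated family without index
      \<open>a\<close> still represents \<open>r * y\<close>, and it is shorter than the
      minimum.\<close>
    let ?S = "(\<lambda>n. n + b) ` (S - {a})" and ?f = "\<lambda>n. f (n - b) * y"
    have "r * y = (\<Sum>n\<in>S. f n * y)"
      by (simp add: r_def sum_distrib_right)
    also have "\<dots> = (\<Sum>n\<in>S - {a}. f n * y)"
      using S(1) a(1) top by (simp add: sum.remove)
    also have "\<dots> = sum ?f ?S"
      by (subst sum.reindex) (auto simp: inj_on_def)
    finally have "P (?S, ?f)"
      using S y R A_mult[OF r(1), of y] \<open>r * y \<noteq> 0\<close> by (auto simp: P_def ring_grading_def)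
    from min[OF this] have "card S \<le> card (S - {a})"
      using card_image_le[of "S - {a}" "\<lambda>n. n + b"] S(1) by (simp add: z)
    then show False
      using card_Diff1_less[OF S(1) a(1)] by linarith
  qed
  have kill_components: "\<forall>b\<in>T. r * h b = 0"
    if "finite T" "\<forall>n\<in>T. h n \<in> R n" "r * sum h T = 0" for T h
    using that
  \<comment> \<open>The inserted degree \<open>b\<close> exceeds all of \<open>T\<close>, so
    \<open>h b\<close> is the top term; once \<open>r\<close> kills it, the hypothesis passes to the
    sum over \<open>T\<close>.\<close>
  proof (induction T rule: finite_linorder_max_induct)
    case (insert b T)
    have "f a * h b = 0"
      using insert.prems insert.hyps
      by (intro ring_grading_top_mult_eq_0[OF R S a, where T = "insert b T"])
         (auto simp: r_def)
    then have b: "r * h b = 0"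
      using kill insert.prems(1) by blast
    moreover have "b \<notin> T"
      using insert.hyps(2) by blast
    ultimately have "r * sum h T = 0"
      using insert.prems(2) insert.hyps(1) by (simp add: distrib_left)
    then show ?case
      using insert.IH insert.prems(1) b by simp
  qed simp
  have "f p * x = 0" if "p \<in> S" "x \<in> I" for p x
  proof -
    obtain T h where T: "finite T" "\<And>n. n \<in> T \<Longrightarrow> h n \<in> R n" "x = sum h T"
      using internal_direct_sum_decompose[OF D, of x] by metis
    have "r * sum h T = 0"
      using r(1) that(2) T(3) by (simp add: A_def annihilator_def)
    \<comment> \<open>Since \<open>h b\<close> is homogeneous, \<open>r * h b = 0\<close> splits by
      degree into its terms.\<close>
    then have "f p * h b = 0" if "b \<in> T" for b
      using kill_components[of T h] T that \<open>p \<in> S\<close>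
      by (intro ring_grading_sum_mult_homogeneous_eq_0[OF R S, of "h b" b]) (auto simp: r_def)
    then show ?thesis
      by (simp add: T(3) sum_distrib_left)
  qed
  moreover obtain p where "p \<in> S" "f p \<noteq> 0"
    using r(2) unfolding r_def by (meson sum.neutral)
  ultimately show ?thesis
    using S(2) unfolding homogeneous_def by blast
qed

end
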